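(* Let $\ell, m, u, v, \alpha$ be positive integers with $u \leq m$, and let $K$ be a set of integers, each at least $2$, with $\ell \in K$. Suppose there exist a TD$(\ell+1,m)$, a TD$(\ell,u)$ containing $\alpha$ pairwise disjoint blocks, a $K$-GDD of type $u^{\ell} v^1$, and an $(mu+1,K)$-PBD. Then for every integer $t$ with $0 \leq t \leq m - \lceil u/\alpha \rceil$ there exists a $K$-GDD of type $\ell^{mu}(tv+1)^1$.
   Context: For a set $K$ of positive integers (each at least $2$), a $K$-GDD (group-divisible design) is a triple $(X,\mathcal{G},\mathcal{A})$ where $X$ is a finite set of points, $\mathcal{G}$ is a partition of $X$ into groups, and $\mathcal{A}$ is a collection of subsets (blocks) of $X$ such that every block meets every group in at most one point, every pair of points from different groups lies in exactly one block, and every block has size in $K$. If $K=\{k\}$ we write $k$-GDD. The type of the GDD is the multiset of group sizes, written exponentially: type $t_1^{u_1} t_2^{u_2}\cdots$ means $u_i$ groups of size $t_i$. A TD$(k,n)$ (transversal design) is a $k$-GDD of type $n^k$. A $(w,K)$-PBD (pairwise balanced design) is a pair $(X,\mathcal{A})$ with $|X|=w$ and $\mathcal{A}$ a collection of subsets (blocks) of $X$ such that every pair of distinct points lies in exactly one block and every block has size in $K$. *)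

theory Defs
  imports Complex_Main "HOL-Library.Multiset" "HOL-Library.Disjoint_Sets"
begin

text \<open>
  Blocks form a plain set of point sets, which loses no multiplicities: as soon as all block
  sizes are at least 2, a repeated block would cover some pair of points twice.
  The predicates do not themselves require the members of \<open>K\<close> to be at least 2.
\<close>

definition gdd :: "nat set \<Rightarrow> 'a set \<Rightarrow> 'a set set \<Rightarrow> 'a set set \<Rightarrow> bool" where
  "gdd K X \<G> \<A> \<longleftrightarrow>
     finite X \<and> partition_on X \<G> \<and>
     (\<forall>B\<in>\<A>. B \<subseteq> X \<and> card B \<in> K) \<and>
     (\<forall>B\<in>\<A>. \<forall>P\<in>\<G>. card (B \<inter> P) \<le> 1) \<and>
     (\<forall>P\<in>\<G>. \<forall>Q\<in>\<G>. P \<noteq> Q \<longrightarrow> (\<forall>x\<in>P. \<forall>y\<in>Q. \<exists>!B. B \<in> \<A> \<and> x \<in> B \<and> y \<in> B))"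

definition gdd_type :: "'a set set \<Rightarrow> nat multiset" where
  "gdd_type \<G> = image_mset card (mset_set \<G>)"

definition transversal_design ::
    "nat \<Rightarrow> nat \<Rightarrow> 'a set \<Rightarrow> 'a set set \<Rightarrow> 'a set set \<Rightarrow> bool" where
  "transversal_design k n X \<G> \<A> \<longleftrightarrow> gdd {k} X \<G> \<A> \<and> gdd_type \<G> = replicate_mset k n"

definition pbd :: "nat \<Rightarrow> nat set \<Rightarrow> 'a set \<Rightarrow> 'a set set \<Rightarrow> bool" where
  "pbd w K X \<A> \<longleftrightarrow>
     finite X \<and> card X = w \<and>
     (\<forall>B\<in>\<A>. B \<subseteq> X \<and> card B \<in> K) \<and>
     (\<forall>x\<in>X. \<forall>y\<in>X. x \<noteq> y \<longrightarrow> (\<exists>!B. B \<in> \<A> \<and> x \<in> B \<and> y \<in> B))"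

text \<open>
  Point sets are finite, so for the bare existence of a design of given parameters it is
  no restriction to take the points to be natural numbers.
\<close>

definition gdd_exists :: "nat set \<Rightarrow> nat multiset \<Rightarrow> bool" where
  "gdd_exists K T \<longleftrightarrow> (\<exists>(X :: nat set) \<G> \<A>. gdd K X \<G> \<A> \<and> gdd_type \<G> = T)"

definition td_exists :: "nat \<Rightarrow> nat \<Rightarrow> bool" where
  "td_exists k n \<longleftrightarrow> (\<exists>(X :: nat set) \<G> \<A>. transversal_design k n X \<G> \<A>)"

definition td_disjoint_blocks_exists :: "nat \<Rightarrow> nat \<Rightarrow> nat \<Rightarrow> bool" where
  "td_disjoint_blocks_exists k n a \<longleftrightarrow>
     (\<exists>(X :: nat set) \<G> \<A> \<D>. transversal_design k n X \<G> \<A> \<and>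
        \<D> \<subseteq> \<A> \<and> card \<D> = a \<and> disjoint \<D>)"

definition pbd_exists :: "nat \<Rightarrow> nat set \<Rightarrow> bool" where
  "pbd_exists w K \<longleftrightarrow> (\<exists>(X :: nat set) \<A>. pbd w K X \<A>)"

end

theory Submission imports Defs begin

text \<open>
  Give weight \<open>u\<close> to the points of \<open>l\<close> groups of a TD\<open>(l+1,m)\<close>; in the last group, give weight \<open>v\<close>
  to \<open>t\<close> points and weight \<open>0\<close> to the other \<open>m - t\<close>. Filling the blocks with copies of the
  \<open>K\<close>-GDD of type \<open>u\<^sup>l v\<^sup>1\<close> or of the TD\<open>(l,u)\<close> yields a \<open>K\<close>-GDD of type
  \<open>(mu)\<^sup>l (tv)\<^sup>1\<close>. The \<open>\<alpha>\<close> disjoint blocks of each TD\<open>(l,u)\<close> may be placed on any \<open>\<alpha>\<close> of the \<open>u\<close>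
  levels; since \<open>(m - t) \<alpha> \<ge> u\<close>, the \<open>m - t\<close> points of weight \<open>0\<close> can share out all levels among
  them, and the resulting horizontal blocks partition the points outside the last group. They
  become the groups of size \<open>l\<close>, while each old group of size \<open>mu\<close>, together with one new common
  point, is filled with the PBD.
\<close>

section \<open>Designs with groups given by a labelling\<close>

text \<open>The groups are the nonempty fibres of \<open>\<gamma>\<close> on \<open>X\<close>.\<close>

definition labelled_gdd :: "nat set \<Rightarrow> 'a set \<Rightarrow> ('a \<Rightarrow> 'b) \<Rightarrow> 'a set set \<Rightarrow> bool" where
  "labelled_gdd K X \<gamma> \<A> \<longleftrightarrow>
     finite X \<and>
     (\<forall>B\<in>\<A>. B \<subseteq> X \<and> card B \<in> K \<and> inj_on \<gamma> B) \<and>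
     (\<forall>x\<in>X. \<forall>y\<in>X. \<gamma> x \<noteq> \<gamma> y \<longrightarrow> (\<exists>!B. B \<in> \<A> \<and> x \<in> B \<and> y \<in> B))"

lemma labelled_gddD:
  assumes "labelled_gdd K X \<gamma> \<A>"
  shows "finite X"
    and "B \<in> \<A> \<Longrightarrow> B \<subseteq> X"
    and "B \<in> \<A> \<Longrightarrow> card B \<in> K"
    and "B \<in> \<A> \<Longrightarrow> inj_on \<gamma> B"
    and "x \<in> X \<Longrightarrow> y \<in> X \<Longrightarrow> \<gamma> x \<noteq> \<gamma> y \<Longrightarrow> \<exists>!B. B \<in> \<A> \<and> x \<in> B \<and> y \<in> B"
  using assms unfolding labelled_gdd_def by simp_all

lemma labelled_gdd_block_unique:
  assumes "labelled_gdd K X \<gamma> \<A>" "B \<in> \<A>" "C \<in> \<A>"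
    and "x \<in> B" "y \<in> B" "x \<in> C" "y \<in> C" "\<gamma> x \<noteq> \<gamma> y"
  shows "B = C"
  using labelled_gddD(2)[OF assms(1,2)] labelled_gddD(5)[OF assms(1), of x y] assms(2-) by blast

lemma labelled_gdd_mono:
  assumes "labelled_gdd K X \<gamma> \<A>" "K \<subseteq> L"
  shows "labelled_gdd L X \<gamma> \<A>"
  using assms unfolding labelled_gdd_def subset_iff by simp

lemma gddD:
  assumes "gdd K X \<G> \<A>"
  shows "finite X" and "partition_on X \<G>"
    and "B \<in> \<A> \<Longrightarrow> B \<subseteq> X"
    and "B \<in> \<A> \<Longrightarrow> card B \<in> K"
    and "B \<in> \<A> \<Longrightarrow> P \<in> \<G> \<Longrightarrow> card (B \<inter> P) \<le> 1"
    and "P \<in> \<G> \<Longrightarrow> Q \<in> \<G> \<Longrightarrow> P \<noteq> Q \<Longrightarrow> x \<in> P \<Longrightarrow> y \<in> Q \<Longrightarrow> \<exists>!B. B \<in> \<A> \<and> x \<in> B \<and> y \<in> B"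
  using assms unfolding gdd_def by simp_all

lemma pbdD:
  assumes "pbd w K X \<A>"
  shows "finite X" and "card X = w"
    and "B \<in> \<A> \<Longrightarrow> B \<subseteq> X"
    and "B \<in> \<A> \<Longrightarrow> card B \<in> K"
    and "x \<in> X \<Longrightarrow> y \<in> X \<Longrightarrow> x \<noteq> y \<Longrightarrow> \<exists>!B. B \<in> \<A> \<and> x \<in> B \<and> y \<in> B"
  using assms unfolding pbd_def by simp_all

text \<open>Every point lies in exactly one group, so the index of that group under \<open>e\<close>
  is a well-defined label; meeting a group in at most one point becomes injectivity of the label on
  the block. The choice of \<open>I\<close> stays free, so that labels can later be matched to a
  prescribed set.\<close>

lemma gdd_imp_labelled_gdd:
  assumes gdd: "gdd K X \<G> \<A>" and e: "bij_betw e I \<G>"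
  obtains \<gamma> where "labelled_gdd K X \<gamma> \<A>" "\<gamma> ` X = I" "\<And>i. i \<in> I \<Longrightarrow> {x\<in>X. \<gamma> x = i} = e i"
proof -
  have part: "partition_on X \<G>" and fin: "finite X"
    using gdd by (auto simp: gdd_def)
  have ex: "\<exists>i\<in>I. x \<in> e i" if "x \<in> X" for x
    using that part e unfolding partition_on_def bij_betw_def by auto
  define \<gamma> where "\<gamma> x = (SOME i. i \<in> I \<and> x \<in> e i)" for x
  have \<gamma>: "\<gamma> x \<in> I" "x \<in> e (\<gamma> x)" if "x \<in> X" for x
    using someI_ex[of "\<lambda>i. i \<in> I \<and> x \<in> e i"] ex[OF that] unfolding \<gamma>_def by auto
  have eG: "e i \<in> \<G>" if "i \<in> I" for i
    using e that by (auto simp: bij_betw_def)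
  have uniq: "i = j" if "i \<in> I" "j \<in> I" "x \<in> e i" "x \<in> e j" for i j x
  proof -
    have "e i = e j"
      using part eG that unfolding partition_on_def disjoint_def by blast
    then show ?thesis
      using e that by (auto simp: bij_betw_def inj_on_def)
  qed
  have sub: "e i \<subseteq> X" if "i \<in> I" for i
    using eG[OF that] part unfolding partition_on_def by auto
  have fib: "{x\<in>X. \<gamma> x = i} = e i" if "i \<in> I" for i
    using \<gamma> uniq sub that by blast
  have ne: "e i \<noteq> {}" if "i \<in> I" for i
    using eG[OF that] part unfolding partition_on_def by auto
  have img: "\<gamma> ` X = I"
  proof (intro equalityI subsetI)
    fix i assume "i \<in> I"
    then have "{x\<in>X. \<gamma> x = i} \<noteq> {}" using fib ne by simp
    then show "i \<in> \<gamma> ` X" by auto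
  qed (use \<gamma>(1) in auto)
  have "inj_on \<gamma> B" if B: "B \<in> \<A>" for B
  proof (rule inj_onI)
    fix x y assume xy: "x \<in> B" "y \<in> B" "\<gamma> x = \<gamma> y"
    have "B \<subseteq> X" using gdd B by (auto simp: gdd_def)
    then have "x \<in> e (\<gamma> x)" "y \<in> e (\<gamma> x)" and E: "e (\<gamma> x) \<in> \<G>"
      using xy \<gamma> eG by (auto simp: subset_iff) metis+
    moreover have "card (B \<inter> e (\<gamma> x)) \<le> Suc 0"
      using gdd B E by (auto simp: gdd_def)
    moreover have "finite (B \<inter> e (\<gamma> x))"
      using \<open>B \<subseteq> X\<close> fin finite_subset by blast
    ultimately show "x = y"
      using xy by (auto simp: card_le_Suc0_iff_eq)
  qed
  moreover have "\<exists>!B. B \<in> \<A> \<and> x \<in> B \<and> y \<in> B" if "x \<in> X" "y \<in> X" "\<gamma> x \<noteq> \<gamma> y" for x y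
  proof -
    have "e (\<gamma> x) \<noteq> e (\<gamma> y)"
      using e \<gamma>(1) that by (auto simp: bij_betw_def inj_on_def)
    then show ?thesis
      using gddD(6)[OF gdd eG[OF \<gamma>(1)] eG[OF \<gamma>(1)] _ \<gamma>(2) \<gamma>(2)] that by simp
  qed
  ultimately have "labelled_gdd K X \<gamma> \<A>"
    using gddD(1,3,4)[OF gdd] unfolding labelled_gdd_def by simp
  from that[OF this img fib] show ?thesis .
qed

section \<open>Transport of designs to prescribed point sets\<close>

text \<open>Induction on \<open>I\<close>: the value \<open>f i\<close> occurs on the right, hence
  equals \<open>g j\<close> for some \<open>j\<close>; pairing \<open>i\<close> with
  \<open>j\<close> removes one occurrence on each side.\<close>

lemma image_mset_eq_imp_bij_betw:
  assumes "finite I" "finite J"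
    and "image_mset f (mset_set I) = image_mset g (mset_set J)"
  shows "\<exists>e. bij_betw e I J \<and> (\<forall>i\<in>I. g (e i) = f i)"
  using assms
proof (induction I arbitrary: J rule: finite_induct)
  case empty
  then have "J = {}" by (simp add: mset_set_empty_iff)
  then show ?case by (simp add: bij_betw_def)
next
  case (insert i I)
  then have "f i \<in># image_mset g (mset_set J)"
    by (metis finite_insert image_eqI insertI1 set_image_mset finite_set_mset_mset_set)
  then obtain j where j: "j \<in> J" "g j = f i"
    using insert.prems by auto
  have "mset_set J = add_mset j (mset_set (J - {j}))"
    using j insert.prems by (simp add: mset_set.remove)
  then have "image_mset f (mset_set I) = image_mset g (mset_set (J - {j}))"
    using insert j by simp
  then obtain e where e: "bij_betw e I (J - {j})" "\<forall>i\<in>I. g (e i) = f i"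
    using insert.IH[of "J - {j}"] insert.prems by auto
  have "bij_betw (e(i := j)) I (J - {j})"
    using e(1) insert.hyps(2) by (subst bij_betw_cong[of I _ e]) auto
  then have "bij_betw (e(i := j)) (insert i I) (insert j (J - {j}))"
    using notIn_Un_bij_betw3[of i I "e(i := j)" "J - {j}"] insert.hyps by simp
  moreover have "insert j (J - {j}) = J" using j by auto
  ultimately show ?case
    using e j insert.hyps by (intro exI[of _ "e(i := j)"] conjI) (simp_all only:, auto)
qed

text \<open>In each fibre \<open>f\<close> uses up equally many points on both sides, so the finite
  remainders have equal size and any bijection between them completes \<open>f\<close>. A nonempty
  \<open>S\<close> forces chosen points into chosen positions; \<open>S = {}\<close> gives a plain
  label-preserving bijection.\<close>

lemma fibrewise_bij_betw_extend:
  assumes fin: "finite X" "finite Y"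
    and card: "\<And>i. card {y\<in>Y. \<delta> y = i} = card {x\<in>X. \<gamma> x = i}"
    and S: "S \<subseteq> Y" and f: "inj_on f S" "f ` S \<subseteq> X" "\<And>y. y \<in> S \<Longrightarrow> \<gamma> (f y) = \<delta> y"
  obtains h where "bij_betw h Y X" "\<And>y. y \<in> Y \<Longrightarrow> \<gamma> (h y) = \<delta> y" "\<And>y. y \<in> S \<Longrightarrow> h y = f y"
proof -
  let ?Y = "\<lambda>i. {y\<in>Y. \<delta> y = i}" and ?X = "\<lambda>i. {x\<in>X. \<gamma> x = i}" and ?S = "\<lambda>i. {y\<in>S. \<delta> y = i}"
  have "\<exists>g. bij_betw g (?Y i - ?S i) (?X i - f ` ?S i)" for i
  proof (rule finite_same_card_bij)
    have "card (f ` ?S i) = card (?S i)"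
      using f(1) by (intro card_image) (auto intro: inj_on_subset)
    moreover have "finite (?S i)" "?S i \<subseteq> ?Y i" "f ` ?S i \<subseteq> ?X i"
      using S f fin finite_subset by (auto intro: finite_subset)
    ultimately show "card (?Y i - ?S i) = card (?X i - f ` ?S i)"
      using card by (simp add: card_Diff_subset)
  qed (use fin in auto)
  then have "\<forall>i. \<exists>g. bij_betw g (?Y i - ?S i) (?X i - f ` ?S i)"
    by (rule allI)
  from choice[OF this] obtain g where g: "\<And>i. bij_betw (g i) (?Y i - ?S i) (?X i - f ` ?S i)"
    by (elim exE) (rule that, erule spec)
  define h where "h y = (if y \<in> S then f y else g (\<delta> y) y)" for y
  have out: "g (\<delta> y) y \<in> ?X (\<delta> y) - f ` ?S (\<delta> y)" if "y \<in> Y" "y \<notin> S" for y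
    using bij_betwE[OF g[of "\<delta> y"]] that by auto
  have lab: "\<gamma> (h y) = \<delta> y" and inX: "h y \<in> X" if "y \<in> Y" for y
    using out[OF that] f that by (auto simp: h_def)
  have "inj_on h Y"
  proof (rule inj_onI)
    fix y z assume yz: "y \<in> Y" "z \<in> Y" "h y = h z"
    then have d: "\<delta> y = \<delta> z" using lab by metis
    have mix: "h a \<noteq> h b" if "a \<in> S" "b \<in> Y" "b \<notin> S" "\<delta> a = \<delta> b" for a b
      using out[of b] that by (force simp: h_def)
    show "y = z"
    proof (cases "y \<in> S")
      case True
      then have "z \<in> S" using mix[of y z] yz d by auto
      then show ?thesis using True yz f(1) by (auto simp: h_def inj_on_def)
    next
      case False
      then have "z \<notin> S" using mix[of z y] yz d by auto
      then show ?thesis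
        using False yz d bij_betw_imp_inj_on[OF g[of "\<delta> z"]]
        by (auto simp: h_def inj_on_def)
    qed
  qed
  moreover have "X \<subseteq> h ` Y"
  proof
    fix x assume x: "x \<in> X"
    show "x \<in> h ` Y"
    proof (cases "x \<in> f ` S")
      case True
      then show ?thesis using S by (force simp: h_def)
    next
      case False
      then have "x \<in> g (\<gamma> x) ` (?Y (\<gamma> x) - ?S (\<gamma> x))"
        using bij_betw_imp_surj_on[OF g[of "\<gamma> x"]] x by auto
      then obtain y where "y \<in> Y" "\<delta> y = \<gamma> x" "y \<notin> S" "x = g (\<gamma> x) y" by auto
      then show ?thesis by (auto simp: h_def intro!: image_eqI[of _ _ y])
    qed
  qed
  ultimately have "bij_betw h Y X"
    using inX by (auto simp: bij_betw_def)
  then show ?thesis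
    using that[of h] lab by (auto simp: h_def)
qed

lemma card_vimage_bij_betw:
  assumes "bij_betw h Y X" "B \<subseteq> X"
  shows "card {y\<in>Y. h y \<in> B} = card B"
proof -
  have "h ` {y\<in>Y. h y \<in> B} = B"
    using bij_betw_imp_surj_on[OF assms(1)] assms(2) by blast
  moreover have "inj_on h {y\<in>Y. h y \<in> B}"
    using assms by (auto simp: bij_betw_def intro: inj_on_subset)
  ultimately show ?thesis using card_image by fastforce
qed

text \<open>Blocks are pulled back rather than pushed forward: \<open>y\<close> lies in the new
  block iff \<open>h y\<close> lies in the old one, so the condition on pairs carries over
  directly.\<close>

lemma labelled_gdd_vimage:
  assumes gdd: "labelled_gdd K X \<gamma> \<A>" and h: "bij_betw h Y X"
    and lab: "\<And>y. y \<in> Y \<Longrightarrow> \<gamma> (h y) = \<delta> y"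
  shows "labelled_gdd K Y \<delta> ((\<lambda>B. {y\<in>Y. h y \<in> B}) ` \<A>)"
  unfolding labelled_gdd_def
proof (intro conjI ballI impI)
  show "finite Y" using h labelled_gddD(1)[OF gdd] bij_betw_finite by blast
  fix B assume "B \<in> (\<lambda>B. {y\<in>Y. h y \<in> B}) ` \<A>"
  then obtain C where C: "C \<in> \<A>" "B = {y\<in>Y. h y \<in> C}" by auto
  then show "B \<subseteq> Y" by auto
  show "card B \<in> K"
    using card_vimage_bij_betw[OF h labelled_gddD(2)[OF gdd C(1)]] labelled_gddD(3)[OF gdd C(1)] C
    by simp
  show "inj_on \<delta> B"
  proof (rule inj_onI)
    fix x y assume xy: "x \<in> B" "y \<in> B" "\<delta> x = \<delta> y"
    then have "\<gamma> (h x) = \<gamma> (h y)" using lab C by simp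
    then have "h x = h y" using labelled_gddD(4)[OF gdd C(1)] xy C by (auto simp: inj_on_def)
    then show "x = y" using h xy C by (auto simp: bij_betw_def inj_on_def)
  qed
next
  fix x y assume xy: "x \<in> Y" "y \<in> Y" "\<delta> x \<noteq> \<delta> y"
  then have "\<exists>!B. B \<in> \<A> \<and> h x \<in> B \<and> h y \<in> B"
    using lab bij_betwE[OF h] by (intro labelled_gddD(5)[OF gdd]) auto
  then show "\<exists>!B. B \<in> (\<lambda>B. {y\<in>Y. h y \<in> B}) ` \<A> \<and> x \<in> B \<and> y \<in> B"
    using xy by (auto simp: Ex1_def image_iff)
qed

text \<open>Outside \<open>I\<close> both fibres are empty, so equal sizes on \<open>I\<close> give
  the equality for every label that \<open>fibrewise_bij_betw_extend\<close> asks for.\<close>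

lemma card_fibre_eq:
  assumes "\<delta> ` Y = I" "\<gamma> ` X = I" "\<And>i. i \<in> I \<Longrightarrow> card {y\<in>Y. \<delta> y = i} = card {x\<in>X. \<gamma> x = i}"
  shows "card {y\<in>Y. \<delta> y = i} = card {x\<in>X. \<gamma> x = i}"
proof (cases "i \<in> I")
  case False
  then have "{y\<in>Y. \<delta> y = i} = {}" "{x\<in>X. \<gamma> x = i} = {}" using assms by auto
  then show ?thesis by (simp only: card.empty)
qed (use assms in auto)

text \<open>Equal types match the groups with the labels of \<open>Y\<close> in a size-preserving
  way; indexing the groups by this matching turns an equality of multisets into equalities of single
  fibre sizes.\<close>

lemma gdd_type_labelled:
  assumes gdd: "gdd K X \<G> \<A>" and fin: "finite Y"
    and type: "gdd_type \<G> = image_mset (\<lambda>i. card {y\<in>Y. \<delta> y = i}) (mset_set (\<delta> ` Y))"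
  obtains \<gamma> where "labelled_gdd K X \<gamma> \<A>" "\<And>i. card {y\<in>Y. \<delta> y = i} = card {x\<in>X. \<gamma> x = i}"
proof -
  have "finite \<G>" using gdd finite_elements by (auto simp: gdd_def)
  then obtain e where e: "bij_betw e (\<delta> ` Y) \<G>" "\<forall>i\<in>\<delta> ` Y. card (e i) = card {y\<in>Y. \<delta> y = i}"
    using image_mset_eq_imp_bij_betw[of "\<delta> ` Y" \<G> "\<lambda>i. card {y\<in>Y. \<delta> y = i}" card] fin type
    by (auto simp: gdd_type_def)
  obtain \<gamma> where \<gamma>: "labelled_gdd K X \<gamma> \<A>" "\<gamma> ` X = \<delta> ` Y"
    "\<And>i. i \<in> \<delta> ` Y \<Longrightarrow> {x\<in>X. \<gamma> x = i} = e i"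
    using gdd_imp_labelled_gdd[OF gdd e(1)] by metis
  have "card {y\<in>Y. \<delta> y = i} = card {x\<in>X. \<gamma> x = i}" for i
  proof (rule card_fibre_eq[OF refl \<gamma>(2)])
    fix j assume j: "j \<in> \<delta> ` Y"
    then show "card {y\<in>Y. \<delta> y = j} = card {x\<in>X. \<gamma> x = j}"
      using bspec[OF e(2) j] \<gamma>(3)[OF j] by simp
  qed
  from that[OF \<gamma>(1) this] show ?thesis .
qed

lemma gdd_relabel:
  assumes gdd: "gdd K X \<G> \<A>" and fin: "finite Y"
    and type: "gdd_type \<G> = image_mset (\<lambda>i. card {y\<in>Y. \<delta> y = i}) (mset_set (\<delta> ` Y))"
  shows "\<exists>\<B>. labelled_gdd K Y \<delta> \<B>"
proof -
  obtain \<gamma> where \<gamma>: "labelled_gdd K X \<gamma> \<A>" "\<And>i. card {y\<in>Y. \<delta> y = i} = card {x\<in>X. \<gamma> x = i}"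
    using gdd_type_labelled[OF assms] by metis
  obtain h where "bij_betw h Y X" "\<And>y. y \<in> Y \<Longrightarrow> \<gamma> (h y) = \<delta> y"
    using fibrewise_bij_betw_extend[OF labelled_gddD(1)[OF \<gamma>(1)] fin \<gamma>(2), of "{}"] by auto
  then show ?thesis using labelled_gdd_vimage[OF \<gamma>(1)] by metis
qed

lemma fibre_Sigma: "{y \<in> Sigma I W. fst y = i} = (if i \<in> I then {i} \<times> W i else {})"
  by auto

lemma fst_image_Sigma: "(\<And>i. i \<in> I \<Longrightarrow> W i \<noteq> {}) \<Longrightarrow> fst ` Sigma I W = I"
  by force

text \<open>The form in which designs are placed on weighted points: a point \<open>i\<close>
  becomes the group \<open>{i} \<times> W i\<close>. An empty \<open>W i\<close> would yield no
  group at all, hence the nonemptiness condition.\<close>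

lemma gdd_relabel_Sigma:
  assumes "gdd K X \<G> \<A>" "finite I" "\<And>i. i \<in> I \<Longrightarrow> finite (W i) \<and> W i \<noteq> {}"
    and "gdd_type \<G> = image_mset (\<lambda>i. card (W i)) (mset_set I)"
  shows "\<exists>\<B>. labelled_gdd K (Sigma I W) fst \<B>"
proof (rule gdd_relabel[OF assms(1)])
  show "gdd_type \<G> = image_mset (\<lambda>i. card {y \<in> Sigma I W. fst y = i}) (mset_set (fst ` Sigma I W))"
    using assms by (auto simp: fst_image_Sigma fibre_Sigma card_cartesian_product
      intro!: image_mset_cong)
qed (use assms in auto)

section \<open>Placing disjoint blocks on prescribed levels\<close>

text \<open>Each block is a transversal of the groups, and disjoint blocks use different points of
  each group. So the points of every group can be numbered such that the block chosen for
  \<open>s\<close> carries the number \<open>s\<close> throughout.\<close>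

lemma transversal_design_horizontal_blocks:
  assumes td: "transversal_design k n X \<G> \<A>" and D: "\<D> \<subseteq> \<A>" "disjoint \<D>"
    and I: "finite I" "card I = k" and n: "n > 0"
    and S: "S \<subseteq> {..<n}" "card S \<le> card \<D>"
  shows "\<exists>\<B>. labelled_gdd {k} (I \<times> {..<n}) fst \<B> \<and> (\<forall>s\<in>S. I \<times> {s} \<in> \<B>)"
proof -
  let ?Y = "I \<times> {..<n}"
  have gdd: "gdd {k} X \<G> \<A>" and type: "gdd_type \<G> = replicate_mset k n"
    using td by (auto simp: transversal_design_def)
  have img: "fst ` ?Y = I" using n by force
  have eq: "gdd_type \<G> = image_mset (\<lambda>i. card {y\<in>?Y. fst y = i}) (mset_set (fst ` ?Y))"
  proof -
    have "image_mset (\<lambda>i. card {y\<in>?Y. fst y = i}) (mset_set I) = image_mset (\<lambda>i. n) (mset_set I)"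
      using I by (intro image_mset_cong) (simp add: fibre_Sigma)
    then show ?thesis using type I img by (simp add: image_mset_const_eq)
  qed
  have "finite ?Y" using I by simp
  from gdd_type_labelled[OF gdd this eq] obtain \<gamma> where \<gamma>: "labelled_gdd {k} X \<gamma> \<A>"
    "\<And>i. card {y\<in>?Y. fst y = i} = card {x\<in>X. \<gamma> x = i}" by blast
  have "\<gamma> ` X \<subseteq> I"
  proof
    fix i assume "i \<in> \<gamma> ` X"
    then have "card {x\<in>X. \<gamma> x = i} \<noteq> 0" using labelled_gddD(1)[OF \<gamma>(1)] by auto
    then have "card {y\<in>?Y. fst y = i} \<noteq> 0" using \<gamma>(2) by simp
    then have "{y\<in>?Y. fst y = i} \<noteq> {}" by (metis card.empty)
    then show "i \<in> I" by auto
  qed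
  \<comment> \<open>A block has \<open>k\<close> points with distinct labels, and only
    \<open>k\<close> labels are available.\<close>
  then have meets: "\<gamma> ` B = I" if "B \<in> \<A>" for B
    using that I labelled_gddD(2,3,4)[OF \<gamma>(1) that]
    by (intro card_subset_eq) (auto simp: card_image)
  \<comment> \<open>Each level gets its own block of \<open>\<D>\<close>. For nonempty
    \<open>S\<close> the cardinality bound makes \<open>card \<D>\<close> positive and hence
    \<open>\<D>\<close> finite; the empty case is trivial.\<close>
  obtain d where d: "d ` S \<subseteq> \<D>" "inj_on d S"
  proof (cases "S = {}")
    case False
    have "finite S" using S(1) finite_subset by blast
    then have "finite \<D>" using S(2) False card_gt_0_iff by fastforce
    then show ?thesis using that card_le_inj[OF \<open>finite S\<close> _ S(2)] by blast
  qed auto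
  have dA: "d s \<in> \<A>" if "s \<in> S" for s using d D that by auto
  \<comment> \<open>\<open>f (i, s)\<close> is the point where the block \<open>d s\<close> meets
    the group labelled \<open>i\<close>.\<close>
  define f where "f y = inv_into (d (snd y)) \<gamma> (fst y)" for y
  have f: "f (i, s) \<in> d s" "\<gamma> (f (i, s)) = i" if "i \<in> I" "s \<in> S" for i s
    using meets[OF dA[OF that(2)]] that by (auto simp: f_def inv_into_into f_inv_into_f)
  have same_level: "s = s'" if "x \<in> d s" "x \<in> d s'" "s \<in> S" "s' \<in> S" for x s s'
  proof -
    have "d s = d s'" using disjointD[OF D(2), of "d s" "d s'"] d(1) that by blast
    then show ?thesis using d(2) that by (simp add: inj_on_def)
  qed
  \<comment> \<open>The level \<open>s\<close> is recovered from the point because the blocks are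
    disjoint, and \<open>i\<close> because it is the label.\<close>
  have "inj_on f (I \<times> S)"
    using f same_level by (intro inj_onI) (clarsimp, metis)
  moreover have "f ` (I \<times> S) \<subseteq> X"
    using f labelled_gddD(2)[OF \<gamma>(1) dA] by blast
  ultimately obtain h where h: "bij_betw h ?Y X" "\<And>y. y \<in> ?Y \<Longrightarrow> \<gamma> (h y) = fst y"
    "\<And>y. y \<in> I \<times> S \<Longrightarrow> h y = f y"
    using fibrewise_bij_betw_extend[of X ?Y fst \<gamma> "I \<times> S" f] labelled_gddD(1)[OF \<gamma>(1)] \<gamma>(2) f I S
    by (smt (verit) Sigma_mono finite_SigmaI finite_lessThan mem_Sigma_iff prod.collapse subset_refl)
  \<comment> \<open>For \<open>y\<close> in the preimage, \<open>h y\<close> and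
    \<open>h (fst y, s)\<close> are points of the block \<open>d s\<close> with the same label; they
    coincide, and injectivity of \<open>h\<close> puts \<open>y\<close> on level
    \<open>s\<close>.\<close>
  have "{y\<in>?Y. h y \<in> d s} = I \<times> {s}" if s: "s \<in> S" for s
  proof (intro equalityI subsetI)
    fix y assume y: "y \<in> {y\<in>?Y. h y \<in> d s}"
    have "f (fst y, s) \<in> d s" "\<gamma> (f (fst y, s)) = \<gamma> (h y)"
      using f[of "fst y" s] h(2)[of y] y s by auto
    then have "h y = f (fst y, s)"
      using labelled_gddD(4)[OF \<gamma>(1) dA[OF s]] y by (auto simp: inj_on_def)
    also have "\<dots> = h (fst y, s)" using h(3) y s by auto
    finally have "y = (fst y, s)"
      using bij_betw_imp_inj_on[OF h(1)] y s S by (auto simp: inj_on_def)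
    then have "snd y = s" by (metis snd_conv)
    with y show "y \<in> I \<times> {s}" by (auto simp: mem_Times_iff)
  next
    fix y assume "y \<in> I \<times> {s}"
    then show "y \<in> {y\<in>?Y. h y \<in> d s}" using h(3) f s S by auto
  qed
  then have "I \<times> {s} \<in> (\<lambda>B. {y\<in>?Y. h y \<in> B}) ` \<A>" if "s \<in> S" for s
    using imageI[OF dA[OF that], of "\<lambda>B. {y\<in>?Y. h y \<in> B}"] that by simp
  then show ?thesis using labelled_gdd_vimage[OF \<gamma>(1) h(1,2)] by blast
qed

section \<open>Weighting, and turning blocks into groups\<close>

text \<open>Wilson's fundamental construction; a point \<open>x\<close> of the master design has weight \<open>card (W x)\<close>.\<close>

lemma labelled_gdd_weighted:
  assumes master: "labelled_gdd L X \<gamma> \<M>" and W: "\<And>x. x \<in> X \<Longrightarrow> finite (W x)"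
    and ingr: "\<And>B. B \<in> \<M> \<Longrightarrow> labelled_gdd K (Sigma B W) fst (\<A> B)"
  shows "labelled_gdd K (Sigma X W) (\<gamma> \<circ> fst) (\<Union>B\<in>\<M>. \<A> B)"
  unfolding labelled_gdd_def
proof (intro conjI ballI impI)
  show "finite (Sigma X W)" using labelled_gddD(1)[OF master] W by auto
  fix C assume "C \<in> (\<Union>B\<in>\<M>. \<A> B)"
  then obtain B where B: "B \<in> \<M>" "C \<in> \<A> B" by auto
  note sub = labelled_gddD(2)[OF ingr[OF B(1)] B(2)]
  show "C \<subseteq> Sigma X W" using sub labelled_gddD(2)[OF master B(1)] by auto
  show "card C \<in> K" using labelled_gddD(3)[OF ingr[OF B(1)] B(2)] .
  show "inj_on (\<gamma> \<circ> fst) C"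
  proof (rule comp_inj_on)
    show "inj_on fst C" using labelled_gddD(4)[OF ingr[OF B(1)] B(2)] .
    show "inj_on \<gamma> (fst ` C)"
      using sub by (intro inj_on_subset[OF labelled_gddD(4)[OF master B(1)]]) auto
  qed
next
  fix p q assume pq: "p \<in> Sigma X W" "q \<in> Sigma X W" "(\<gamma> \<circ> fst) p \<noteq> (\<gamma> \<circ> fst) q"
  have "fst p \<in> X" "fst q \<in> X" using pq by auto
  then have "\<exists>!B. B \<in> \<M> \<and> fst p \<in> B \<and> fst q \<in> B"
    using pq by (intro labelled_gddD(5)[OF master]) simp_all
  then obtain B where B: "B \<in> \<M>" "fst p \<in> B" "fst q \<in> B"
    by (elim ex1E conjE)
  have Bu: "B' = B" if "B' \<in> \<M>" "fst p \<in> B'" "fst q \<in> B'" for B'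
    using labelled_gdd_block_unique[OF master that(1) B(1)] B that pq by simp
  have "p \<in> Sigma B W" "q \<in> Sigma B W" "fst p \<noteq> fst q" using B pq by auto
  then have ex1: "\<exists>!C. C \<in> \<A> B \<and> p \<in> C \<and> q \<in> C"
    by (rule labelled_gddD(5)[OF ingr[OF B(1)]])
  \<comment> \<open>An ingredient block through \<open>p\<close> and \<open>q\<close> projects into
    its master block, which then contains \<open>fst p\<close> and \<open>fst q\<close> and must be
    \<open>B\<close>.\<close>
  have in_B: "C \<in> \<A> B" if "B' \<in> \<M>" "C \<in> \<A> B'" "p \<in> C" "q \<in> C" for B' C
  proof -
    have "C \<subseteq> Sigma B' W" using labelled_gddD(2)[OF ingr] that by blast
    then have "B' = B" using that by (intro Bu) auto
    then show ?thesis using that by simp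
  qed
  have "C \<in> (\<Union>B\<in>\<M>. \<A> B) \<and> p \<in> C \<and> q \<in> C \<longleftrightarrow> C \<in> \<A> B \<and> p \<in> C \<and> q \<in> C" for C
    using B(1) in_B by blast
  then show "\<exists>!C. C \<in> (\<Union>B\<in>\<M>. \<A> B) \<and> p \<in> C \<and> q \<in> C"
    using ex1 by (simp only:)
qed

text \<open>A block in \<open>\<H>\<close> has at most one point in each old group, so once these
  blocks become groups, pairs inside the old groups other than \<open>z\<close> need new blocks; the
  PBDs supply them and also join \<open>p\<close> to all those points. The old group
  \<open>z\<close> absorbs \<open>p\<close> and stays a group. Pairs with different labels keep
  their old block unless it lies in \<open>\<H>\<close>, where they now share a group.\<close>

lemma labelled_gdd_blocks_to_groups:
  assumes gdd: "labelled_gdd K X \<gamma> \<A>" and H: "\<H> \<subseteq> \<A>" "partition_on {x\<in>X. \<gamma> x \<noteq> z} \<H>"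
    and p: "p \<notin> X"
    and P: "\<And>i. i \<in> \<gamma> ` X - {z} \<Longrightarrow> pbd (w i) K (insert p {x\<in>X. \<gamma> x = i}) (\<P> i)"
  shows "gdd K (insert p X) (insert (insert p {x\<in>X. \<gamma> x = z}) \<H>)
           ((\<A> - \<H>) \<union> (\<Union>i \<in> \<gamma> ` X - {z}. \<P> i))"
proof -
  define I where "I = \<gamma> ` X - {z}"
  define Z where "Z = insert p {x\<in>X. \<gamma> x = z}"
  define \<B> where "\<B> = (\<A> - \<H>) \<union> (\<Union>i\<in>I. \<P> i)"
  have HX: "\<Union>\<H> = {x\<in>X. \<gamma> x \<noteq> z}" and Hne: "{} \<notin> \<H>" and Hd: "disjoint \<H>"
    using H(2) by (auto simp: partition_on_def)
  have Psub: "B \<subseteq> insert p {x\<in>X. \<gamma> x = i}" "card B \<in> K" if "i \<in> I" "B \<in> \<P> i" for i B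
    using pbdD(3,4)[OF P[folded I_def]] that by metis+
  have Pex: "\<exists>!B. B \<in> \<P> i \<and> x \<in> B \<and> y \<in> B"
    if "i \<in> I" "x \<in> insert p {x\<in>X. \<gamma> x = i}" "y \<in> insert p {x\<in>X. \<gamma> x = i}" "x \<noteq> y" for i x y
    using pbdD(5)[OF P[folded I_def, OF that(1)] that(2-4)] .
  have finX: "finite X" using labelled_gddD(1)[OF gdd] .
  have Asub: "B \<subseteq> X" if "B \<in> \<A>" for B using labelled_gddD(2)[OF gdd that] .
  have Hsub: "h \<subseteq> {x\<in>X. \<gamma> x \<noteq> z}" if "h \<in> \<H>" for h using HX that by auto
  have pH: "p \<notin> h" if "h \<in> \<H>" for h using Hsub that p by auto
  have part: "partition_on (insert p X) (insert Z \<H>)"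
  proof (rule partition_onI)
    show "\<Union>(insert Z \<H>) = insert p X" using HX by (auto simp: Z_def)
    show "disjnt g h" if "g \<in> insert Z \<H>" "h \<in> insert Z \<H>" "g \<noteq> h" for g h
      using that Hd Hsub pH by (fastforce simp: Z_def disjnt_def disjoint_def)
    show "{} \<notin> insert Z \<H>" using Hne by (auto simp: Z_def)
  qed
  \<comment> \<open>Two points of a surviving old block have different labels, which excludes
    \<open>Z\<close> and forces \<open>B = h\<close> for \<open>h\<close> in \<open>\<H>\<close>. A
    PBD block stays within one old group other than \<open>z\<close> and \<open>p\<close>, so it
    meets a member of \<open>\<H>\<close> at most once and \<open>Z\<close> at most in
    \<open>p\<close>.\<close>
  have meet: "x = y"
    if B: "B \<in> \<B>" and h: "h \<in> insert Z \<H>" and xy: "x \<in> B" "y \<in> B" "x \<in> h" "y \<in> h" for B h x y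
  proof (rule ccontr)
    assume ne: "x \<noteq> y"
    show False
    proof (cases "B \<in> \<A> - \<H>")
      case True
      have "inj_on \<gamma> B" using labelled_gddD(4)[OF gdd] True by auto
      then have lab: "\<gamma> x \<noteq> \<gamma> y" using xy ne by (auto simp: inj_on_def)
      have X: "x \<in> X" "y \<in> X" using Asub True xy by auto
      then have "h \<noteq> Z" using lab xy p by (auto simp: Z_def)
      then have "h \<in> \<H>" using h by auto
      then have "B = h"
        using labelled_gdd_block_unique[OF gdd, of B h x y] True H(1) xy lab by auto
      then show False using \<open>h \<in> \<H>\<close> True by auto
    next
      case False
      then obtain i where i: "i \<in> I" "B \<in> \<P> i" using B by (auto simp: \<B>_def)
      then have sub: "x \<in> insert p {x\<in>X. \<gamma> x = i}" "y \<in> insert p {x\<in>X. \<gamma> x = i}"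
        using Psub xy by blast+
      show False
      proof (cases "h \<in> \<H>")
        case True
        then have "x \<noteq> p" "y \<noteq> p" using pH xy by auto
        then have "\<gamma> x = \<gamma> y" using sub by auto
        moreover have "inj_on \<gamma> h" using labelled_gddD(4)[OF gdd] True H(1) by auto
        ultimately show False using xy ne by (auto simp: inj_on_def)
      next
        case False
        then have "h = Z" using h by auto
        then show False using sub xy ne i by (auto simp: Z_def I_def)
      qed
    qed
  qed
  have not_P: "B \<notin> (\<Union>i\<in>I. \<P> i)" if "x \<in> X" "y \<in> X" "\<gamma> x \<noteq> \<gamma> y" "x \<in> B" "y \<in> B" for B x y
  proof
    assume "B \<in> (\<Union>i\<in>I. \<P> i)"
    then obtain i where "i \<in> I" "B \<in> \<P> i" by auto
    then have "B \<subseteq> insert p {x\<in>X. \<gamma> x = i}" using Psub by auto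
    then show False using that p by auto
  qed
  \<comment> \<open>Handles two points of one old group other than \<open>z\<close>, and
    \<open>p\<close> together with a point of such a group: no old block contains such a pair, and a
    point of \<open>X\<close> lies in PBD blocks of its own group only.\<close>
  have P_case: "\<exists>!B. B \<in> \<B> \<and> x \<in> B \<and> y \<in> B"
    if i: "\<gamma> x = i" "i \<in> I" and xy: "x \<in> X" "y \<in> insert p {x\<in>X. \<gamma> x = i}" "x \<noteq> y" for x y i
  proof -
    have "\<exists>!B. B \<in> \<P> i \<and> x \<in> B \<and> y \<in> B" using Pex i xy by auto
    moreover have "B \<in> \<P> i" if B: "B \<in> \<B>" "x \<in> B" "y \<in> B" for B
    proof -
      have "B \<notin> \<A>"
      proof
        assume "B \<in> \<A>"
        then have "inj_on \<gamma> B" "B \<subseteq> X" using labelled_gddD(2,4)[OF gdd] by auto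
        then show False using B xy i p by (auto simp: inj_on_def)
      qed
      then obtain j where j: "j \<in> I" "B \<in> \<P> j" using B by (auto simp: \<B>_def)
      then have "B \<subseteq> insert p {x\<in>X. \<gamma> x = j}" using Psub by auto
      then have "j = i" using B xy(1) i p by auto
      then show ?thesis using j by simp
    qed
    moreover have "\<P> i \<subseteq> \<B>" using i by (auto simp: \<B>_def)
    ultimately show ?thesis by (auto simp: Ex1_def)
  qed
  \<comment> \<open>Points with different labels that share no member of \<open>\<H>\<close> keep
    exactly their old block, since PBD blocks contain no such pair.\<close>
  have A_case: "\<exists>!B. B \<in> \<B> \<and> x \<in> B \<and> y \<in> B"
    if xy: "x \<in> X" "y \<in> X" "\<gamma> x \<noteq> \<gamma> y" and notH: "\<And>h. h \<in> \<H> \<Longrightarrow> x \<in> h \<Longrightarrow> y \<in> h \<Longrightarrow> False" for x y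
  proof (rule ex_ex1I)
    obtain B where "B \<in> \<A>" "x \<in> B" "y \<in> B"
      using labelled_gddD(5)[OF gdd xy] by (elim ex1E) auto
    then show "\<exists>B. B \<in> \<B> \<and> x \<in> B \<and> y \<in> B" using notH unfolding \<B>_def by blast
  next
    fix B C assume "B \<in> \<B> \<and> x \<in> B \<and> y \<in> B" "C \<in> \<B> \<and> x \<in> C \<and> y \<in> C"
    then show "B = C"
      using not_P[OF xy] labelled_gdd_block_unique[OF gdd, of B C x y] xy unfolding \<B>_def by blast
  qed
  have sym: "(\<exists>!B. B \<in> \<B> \<and> x \<in> B \<and> y \<in> B) \<longleftrightarrow> (\<exists>!B. B \<in> \<B> \<and> y \<in> B \<and> x \<in> B)" for x y
    by (simp add: conj_commute)
  have pairs: "\<exists>!B. B \<in> \<B> \<and> x \<in> B \<and> y \<in> B"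
    if gh: "g \<in> insert Z \<H>" "h \<in> insert Z \<H>" "g \<noteq> h" and xy: "x \<in> g" "y \<in> h" for g h x y
  proof -
    have notH: False if "k \<in> \<H>" "x \<in> k" "y \<in> k" for k
    proof -
      have "k = g" "k = h"
        using disjointD[OF partition_onD2[OF part], of k] that gh xy by blast+
      then show False using gh by simp
    qed
    have ne: "x \<noteq> y"
      using disjointD[OF partition_onD2[OF part] gh] xy by blast
    \<comment> \<open>The only group containing \<open>p\<close> is \<open>Z\<close>, so a partner
      of \<open>p\<close> from a different group lies in a member of \<open>\<H>\<close>.\<close>
    consider (X) "x \<in> X" "y \<in> X" | (py) "y = p" "g \<in> \<H>" | (px) "x = p" "h \<in> \<H>"
      using gh xy Hsub by (auto simp: Z_def)
    then show ?thesis
    proof cases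
      case X
      show ?thesis
      proof (cases "\<gamma> x = \<gamma> y")
        case True
        \<comment> \<open>Points labelled \<open>z\<close> lie only in \<open>Z\<close>, so two of
          them cannot come from different groups.\<close>
        have "\<gamma> x \<noteq> z"
          using gh xy True Hsub by auto
        then show ?thesis using P_case[of x "\<gamma> x" y] X True ne by (auto simp: I_def)
      next
        case False
        then show ?thesis using A_case X notH by blast
      qed
    next
      case py
      then have "x \<in> X" "\<gamma> x \<noteq> z" using Hsub xy by auto
      then show ?thesis using P_case[of x "\<gamma> x" y] py ne by (auto simp: I_def)
    next
      case px
      then have "y \<in> X" "\<gamma> y \<noteq> z" using Hsub xy by auto
      then show ?thesis using P_case[of y "\<gamma> y" x] px ne sym[of x y] by (auto simp: I_def)
    qed
  qed
  have blocks: "B \<subseteq> insert p X" "card B \<in> K" if "B \<in> \<B>" for B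
    using that Psub labelled_gddD(2,3)[OF gdd] unfolding \<B>_def by blast+
  have "card (B \<inter> h) \<le> 1" if "B \<in> \<B>" "h \<in> insert Z \<H>" for B h
  proof -
    have "finite (B \<inter> h)"
      using blocks(1)[OF that(1)] finX by (meson finite_Int finite_insert finite_subset)
    then show ?thesis using meet[OF that] by (auto simp: card_le_Suc0_iff_eq)
  qed
  then have "gdd K (insert p X) (insert Z \<H>) \<B>"
    using finX part pairs blocks unfolding gdd_def by (intro conjI ballI impI) auto
  then show ?thesis by (simp add: Z_def \<B>_def I_def)
qed

section \<open>Change of point set for PBDs and for the final GDD\<close>

lemma pbd_relabel:
  assumes pbd: "pbd w K X \<A>" and Y: "finite Y" "card Y = w"
  shows "\<exists>\<B>. pbd w K Y \<B>"
proof -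
  have X: "finite X" "card X = w" using pbd by (auto simp: pbd_def)
  then obtain h where h: "bij_betw h Y X"
    using finite_same_card_bij Y by metis
  have "pbd w K Y ((\<lambda>B. {y\<in>Y. h y \<in> B}) ` \<A>)"
    unfolding pbd_def
  proof (intro conjI ballI impI)
    fix B assume "B \<in> (\<lambda>B. {y\<in>Y. h y \<in> B}) ` \<A>"
    then obtain C where C: "C \<in> \<A>" "B = {y\<in>Y. h y \<in> C}" by auto
    then show "B \<subseteq> Y" by auto
    have "C \<subseteq> X" "card C \<in> K" using C pbd by (auto simp: pbd_def)
    then show "card B \<in> K" using card_vimage_bij_betw[OF h] C by simp
  next
    fix x y assume xy: "x \<in> Y" "y \<in> Y" "x \<noteq> y"
    then have "h x \<in> X" "h y \<in> X" "h x \<noteq> h y"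
      using h by (auto simp: bij_betw_def inj_on_def)
    then have "\<exists>!B. B \<in> \<A> \<and> h x \<in> B \<and> h y \<in> B" using pbd by (auto simp: pbd_def)
    then show "\<exists>!B. B \<in> (\<lambda>B. {y\<in>Y. h y \<in> B}) ` \<A> \<and> x \<in> B \<and> y \<in> B"
      using xy by (auto simp: Ex1_def image_iff)
  qed (use Y in auto)
  then show ?thesis by blast
qed

text \<open>The construction lives on nested pairs, while \<open>gdd_exists\<close> asks for natural
  numbers as points; a finite set injects into them, and an injective image preserves the
  design.\<close>

lemma gdd_imp_gdd_exists:
  assumes gdd: "gdd K X \<G> \<A>"
  shows "gdd_exists K (gdd_type \<G>)"
proof -
  have fin: "finite X" and part: "partition_on X \<G>" and bl: "\<And>B. B \<in> \<A> \<Longrightarrow> B \<subseteq> X \<and> card B \<in> K"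
    using gdd by (auto simp: gdd_def)
  obtain h :: "'a \<Rightarrow> nat" where h: "inj_on h X"
    using fin finite_imp_inj_to_nat_seg by metis
  have gr: "P \<subseteq> X" if "P \<in> \<G>" for P using part that by (auto simp: partition_on_def)
  have inj: "inj_on h P" if "P \<subseteq> X" for P using h that inj_on_subset by blast
  have mem: "h x \<in> h ` B \<longleftrightarrow> x \<in> B" if "x \<in> X" "B \<subseteq> X" for x B
    using inj_on_image_mem_iff[OF h] that by blast
  have "gdd K (h ` X) ((`) h ` \<G>) ((`) h ` \<A>)"
    unfolding gdd_def
  proof (intro conjI)
    show "finite (h ` X)" using fin by simp
    show "partition_on (h ` X) ((`) h ` \<G>)"
    proof -
      have "{} \<notin> (`) h ` \<G>" using partition_onD3[OF part] by auto
      then show ?thesis using partition_on_inj_image[OF part h] by simp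
    qed
    show "\<forall>B\<in>(`) h ` \<A>. B \<subseteq> h ` X \<and> card B \<in> K"
      using bl inj by (auto simp: card_image)
    show "\<forall>B\<in>(`) h ` \<A>. \<forall>P\<in>(`) h ` \<G>. card (B \<inter> P) \<le> 1"
    proof (clarsimp)
      fix B P assume BP: "B \<in> \<A>" "P \<in> \<G>"
      then have "h ` B \<inter> h ` P = h ` (B \<inter> P)"
        using inj_on_image_Int[OF h] bl gr by metis
      moreover have "card (h ` (B \<inter> P)) = card (B \<inter> P)"
        using bl[OF BP(1)] by (intro card_image inj) auto
      ultimately show "card (h ` B \<inter> h ` P) \<le> Suc 0" using gdd BP by (auto simp: gdd_def)
    qed
    show "\<forall>P\<in>(`) h ` \<G>. \<forall>Q\<in>(`) h ` \<G>. P \<noteq> Q \<longrightarrow>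
      (\<forall>x\<in>P. \<forall>y\<in>Q. \<exists>!B. B \<in> (`) h ` \<A> \<and> x \<in> B \<and> y \<in> B)"
    proof (clarify)
      fix P Q x y assume PQ: "P \<in> \<G>" "Q \<in> \<G>" "h ` P \<noteq> h ` Q" and xy: "x \<in> P" "y \<in> Q"
      then have "\<exists>!B. B \<in> \<A> \<and> x \<in> B \<and> y \<in> B" using gddD(6)[OF gdd PQ(1,2) _ xy] by auto
      then obtain B where B: "B \<in> \<A> \<and> x \<in> B \<and> y \<in> B"
        and unique: "\<forall>C. C \<in> \<A> \<and> x \<in> C \<and> y \<in> C \<longrightarrow> C = B"
        by (rule ex1E)
      have "x \<in> X" "y \<in> X" using gr PQ xy by auto
      then have mem': "h x \<in> h ` C \<longleftrightarrow> x \<in> C" "h y \<in> h ` C \<longleftrightarrow> y \<in> C" if "C \<in> \<A>" for C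
        using mem bl[OF that] by simp_all
      show "\<exists>!B. B \<in> (`) h ` \<A> \<and> h x \<in> B \<and> h y \<in> B"
      proof (rule ex1I[of _ "h ` B"])
        fix D assume D: "D \<in> (`) h ` \<A> \<and> h x \<in> D \<and> h y \<in> D"
        then obtain C where "C \<in> \<A>" "D = h ` C" by auto
        with D show "D = h ` B" using mem'[of C] unique by simp
      qed (use B in auto)
    qed
  qed
  moreover have "gdd_type ((`) h ` \<G>) = gdd_type \<G>"
  proof -
    \<comment> \<open>Distinct groups have distinct images, so no multiplicity in the type is
      lost.\<close>
    have "inj_on ((`) h) \<G>"
      using inj_on_image_Pow[OF h] gr by (meson PowI inj_on_subset subsetI)
    then have "gdd_type ((`) h ` \<G>) = image_mset (\<lambda>P. card (h ` P)) (mset_set \<G>)"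
      unfolding gdd_type_def
      by (simp add: image_mset_mset_set[symmetric] multiset.map_comp comp_def)
    also have "\<dots> = gdd_type \<G>"
      unfolding gdd_type_def using gr inj finite_elements[OF fin part]
      by (intro image_mset_cong) (auto simp: card_image)
    finally show ?thesis .
  qed
  ultimately show ?thesis unfolding gdd_exists_def by blast
qed

section \<open>Assembly of the construction\<close>

theorem theorem3:
  fixes l m u v \<alpha> t :: nat and K :: "nat set"
  assumes "l > 0" "m > 0" "u > 0" "v > 0" "\<alpha> > 0"
    and "u \<le> m"
    and "\<forall>k\<in>K. k \<ge> 2" and "l \<in> K"
    and "td_exists (l + 1) m"
    and "td_disjoint_blocks_exists l u \<alpha>"
    and "gdd_exists K (replicate_mset l u + {#v#})"
    and "pbd_exists (m * u + 1) K"
    and "int t \<le> int m - \<lceil>real u / real \<alpha>\<rceil>"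
  shows "gdd_exists K (replicate_mset (m * u) l + {#t * v + 1#})"
proof -
  \<comment> \<open>The ceiling bound, freed of division: the \<open>m - t\<close> points of weight
    \<open>0\<close> can serve all \<open>u\<close> levels with at most \<open>\<alpha>\<close>
    levels each. Having \<open>t \<le> m\<close> first makes \<open>m - t\<close> a true
    difference.\<close>
  have u_le: "u \<le> (m - t) * \<alpha>" and t_le: "t \<le> m"
  proof -
    have "0 \<le> real u / real \<alpha>" by simp
    then have "0 \<le> \<lceil>real u / real \<alpha>\<rceil>" by linarith
    then show "t \<le> m" using assms(13) by linarith
    then have "\<lceil>real u / real \<alpha>\<rceil> \<le> int (m - t)" using assms(13) by (simp add: of_nat_diff)
    then have "real u / real \<alpha> \<le> real (m - t)" by (simp add: ceiling_le_iff)
    then have "real u \<le> real ((m - t) * \<alpha>)" using assms(5) by (simp add: field_simps)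
    then show "u \<le> (m - t) * \<alpha>" by linarith
  qed
  \<comment> \<open>\<open>{..l}\<close> provides the \<open>l + 1\<close> groups of the master
    design; the label \<open>l\<close> marks the last one.\<close>
  define X where "X = {..l} \<times> {..<m}"
  \<comment> \<open>Level \<open>s\<close> is assigned to the point
    \<open>(l, t + s div \<alpha>)\<close>: the offset \<open>t\<close> skips the points of weight
    \<open>v\<close>, and division by \<open>\<alpha>\<close> sends at most \<open>\<alpha>\<close>
    levels to one point.\<close>
  have level: "t + s div \<alpha> < m" if "s < u" for s
  proof -
    have "s < (m - t) * \<alpha>" using that u_le by simp
    then have "s div \<alpha> < m - t" by (simp add: less_mult_imp_div_less)
    then show ?thesis by simp
  qed
  obtain \<M> where \<M>: "labelled_gdd {l + 1} X fst \<M>"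
  proof -
    obtain Y :: "nat set" and \<G> \<A> where "gdd {l + 1} Y \<G> \<A>" "gdd_type \<G> = replicate_mset (l + 1) m"
      using assms(9) unfolding td_exists_def transversal_design_def by blast
    then show ?thesis
      using gdd_relabel_Sigma[of "{l + 1}" Y \<G> \<A> "{..l}" "\<lambda>_. {..<m}"] assms(2) that
      by (auto simp: X_def image_mset_const_eq)
  qed
  have fst_block: "fst ` B = {..l}" if "B \<in> \<M>" for B
    using labelled_gddD(2,3,4)[OF \<M> that]
    by (intro card_subset_eq) (auto simp: X_def card_image)
  \<comment> \<open>Weights are encoded as sets of levels, the empty set standing for weight
    \<open>0\<close>.\<close>
  define W where "W x = (if fst x < l then {..<u} else if snd x < t then {..<v} else {})"
    for x :: "nat \<times> nat"
  define B\<^sub>0 where "B\<^sub>0 B = {x\<in>B. fst x < l}" for B :: "(nat \<times> nat) set"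
  \<comment> \<open>With \<open>l + 1\<close> points, a master block meets each group once;
    \<open>(l, c)\<close> is its point in the last group, and \<open>B\<^sub>0 B\<close> consists of
    the other \<open>l\<close> points, all of weight \<open>u\<close>.\<close>
  have block: "\<exists>c<m. B = insert (l, c) (B\<^sub>0 B)" "card (B\<^sub>0 B) = l" "finite (B\<^sub>0 B)" if B: "B \<in> \<M>" for B
  proof -
    have "l \<in> fst ` B" using fst_block[OF B] by simp
    then obtain c where c: "(l, c) \<in> B" by auto
    have sub: "B \<subseteq> X" and inj: "inj_on fst B" using labelled_gddD(2,4)[OF \<M> B] by auto
    have fin: "finite B" using sub by (rule finite_subset) (simp add: X_def)
    then show "finite (B\<^sub>0 B)" by (simp add: B\<^sub>0_def)
    have "x \<in> insert (l, c) (B\<^sub>0 B)" if "x \<in> B" for x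
    proof (cases "fst x = l")
      case True
      then have "x = (l, c)" using inj c that by (auto simp: inj_on_def)
      then show ?thesis by simp
    next
      case False
      then show ?thesis using that sub by (auto simp: B\<^sub>0_def X_def)
    qed
    then have eq: "B = insert (l, c) (B\<^sub>0 B)" using c by (auto simp: B\<^sub>0_def)
    moreover have "c < m" using c sub by (auto simp: X_def)
    ultimately show "\<exists>c<m. B = insert (l, c) (B\<^sub>0 B)" by blast
    have "(l, c) \<notin> B\<^sub>0 B" by (simp add: B\<^sub>0_def)
    then have "card B = Suc (card (B\<^sub>0 B))" using eq \<open>finite (B\<^sub>0 B)\<close> by (metis card_insert_disjoint)
    then show "card (B\<^sub>0 B) = l" using labelled_gddD(3)[OF \<M> B] by simp
  qed
  \<comment> \<open>Horizontal blocks are demanded only at the levels assigned to the last-group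
    point of \<open>B\<close>, so no ingredient has to provide more than \<open>\<alpha>\<close> of
    them.\<close>
  have "\<exists>\<A>. labelled_gdd K (Sigma B W) fst \<A> \<and>
      (\<forall>s<u. (l, t + s div \<alpha>) \<in> B \<longrightarrow> B\<^sub>0 B \<times> {s} \<in> \<A>)" if B: "B \<in> \<M>" for B
  proof -
    obtain c where c: "B = insert (l, c) (B\<^sub>0 B)" using block(1)[OF B] by auto
    have last: "(l, d) \<in> B \<longleftrightarrow> d = c" for d by (subst c) (simp add: B\<^sub>0_def)
    have notin: "(l, c) \<notin> B\<^sub>0 B" by (simp add: B\<^sub>0_def)
    have W0: "W x = {..<u}" if "x \<in> B\<^sub>0 B" for x using that by (simp add: W_def B\<^sub>0_def)
    show ?thesis
    proof (cases "c < t")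
      case True
      then have Wc: "W (l, c) = {..<v}" by (simp add: W_def)
      obtain Y :: "nat set" and \<G> \<A> where
        gdd: "gdd K Y \<G> \<A>" and type: "gdd_type \<G> = replicate_mset l u + {#v#}"
        using assms(11) unfolding gdd_exists_def by blast
      have "image_mset (\<lambda>x. card (W x)) (mset_set (B\<^sub>0 B)) = image_mset (\<lambda>x. u) (mset_set (B\<^sub>0 B))"
        using block(3)[OF B] W0 by (intro image_mset_cong) simp
      then have "image_mset (\<lambda>x. card (W x)) (mset_set B) = replicate_mset l u + {#v#}"
        using notin block(2,3)[OF B] Wc by (subst c) (simp add: image_mset_const_eq)
      moreover have "finite (W x) \<and> W x \<noteq> {}" if "x \<in> B" for x
        using that W0 Wc assms(3,4) c by (metis finite_lessThan insert_iff lessThan_empty_iff not_gr0)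
      moreover have "finite B" using block(3)[OF B] c by (metis finite_insert)
      ultimately obtain \<A>' where "labelled_gdd K (Sigma B W) fst \<A>'"
        using gdd_relabel_Sigma[OF gdd, of B W] type by auto
      \<comment> \<open>Levels are assigned only to points with second coordinate at least
        \<open>t\<close>, so in this case no horizontal block is demanded.\<close>
      moreover have "(l, t + s div \<alpha>) \<notin> B" for s using last True by auto
      ultimately show ?thesis by blast
    next
      case False
      obtain Y :: "nat set" and \<G> \<A> \<D> where
        td: "transversal_design l u Y \<G> \<A>" "\<D> \<subseteq> \<A>" "disjoint \<D>" "card \<D> = \<alpha>"
        using assms(10) unfolding td_disjoint_blocks_exists_def by blast
      define S where "S = {s. s < u \<and> t + s div \<alpha> = c}"
      \<comment> \<open>The levels served by \<open>(l, c)\<close> are among \<open>\<alpha>\<close>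
        consecutive numbers, so the \<open>\<alpha>\<close> disjoint blocks suffice.\<close>
      have "S \<subseteq> {(c - t) * \<alpha>..<(c - t) * \<alpha> + \<alpha>}"
      proof
        fix s assume "s \<in> S"
        then have "c - t = s div \<alpha>" by (auto simp: S_def)
        then show "s \<in> {(c - t) * \<alpha>..<(c - t) * \<alpha> + \<alpha>}"
          using dividend_less_div_times[OF assms(5), of s] by (simp add: add.commute)
      qed
      from card_mono[OF finite_atLeastLessThan this] have "card S \<le> \<alpha>" by simp
      then obtain \<A>' where "labelled_gdd {l} (B\<^sub>0 B \<times> {..<u}) fst \<A>'"
        and horizontal: "\<forall>s\<in>S. B\<^sub>0 B \<times> {s} \<in> \<A>'"
        using transversal_design_horizontal_blocks[OF td(1-3) block(3,2)[OF B] assms(3), of S] td(4)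
        by (auto simp: S_def)
      \<comment> \<open>The point of weight \<open>0\<close> disappears, which leaves
        \<open>l\<close> groups of size \<open>u\<close>.\<close>
      moreover have "Sigma B W = B\<^sub>0 B \<times> {..<u}"
      proof -
        have "W (l, c) = {}" using False by (simp add: W_def)
        then have "Sigma B W = Sigma (B\<^sub>0 B) W" by (subst c) auto
        then show ?thesis using W0 by auto
      qed
      ultimately have "labelled_gdd K (Sigma B W) fst \<A>'"
        using labelled_gdd_mono[of "{l}" _ _ _ K] assms(8) by simp
      with horizontal show ?thesis
        using last by (intro exI[of _ \<A>']) (simp add: S_def)
    qed
  qed
  then have "\<forall>B\<in>\<M>. \<exists>\<A>. labelled_gdd K (Sigma B W) fst \<A> \<and>
      (\<forall>s<u. (l, t + s div \<alpha>) \<in> B \<longrightarrow> B\<^sub>0 B \<times> {s} \<in> \<A>)"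
    by (rule ballI)
  from bchoice[OF this] obtain \<A> where \<A>: "\<And>B. B \<in> \<M> \<Longrightarrow> labelled_gdd K (Sigma B W) fst (\<A> B)"
    and horiz: "\<And>B s. B \<in> \<M> \<Longrightarrow> s < u \<Longrightarrow> (l, t + s div \<alpha>) \<in> B \<Longrightarrow> B\<^sub>0 B \<times> {s} \<in> \<A> B"
    by auto
  let ?X = "Sigma X W" and ?\<gamma> = "fst \<circ> fst"
  have gdd: "labelled_gdd K ?X ?\<gamma> (\<Union>B\<in>\<M>. \<A> B)"
    using labelled_gdd_weighted[OF \<M> _ \<A>] by (auto simp: W_def)
  define \<H> where "\<H> = {B\<^sub>0 B \<times> {s} | B s. B \<in> \<M> \<and> s < u \<and> (l, t + s div \<alpha>) \<in> B}"
  have low: "{x\<in>?X. ?\<gamma> x \<noteq> l} = ({..<l} \<times> {..<m}) \<times> {..<u}"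
    by (auto simp: X_def W_def)
  \<comment> \<open>A point \<open>((i, a), s)\<close> belongs to the horizontal block of the unique
    master block joining \<open>(i, a)\<close> to the point that serves level \<open>s\<close>;
    existence of that block gives the covering, uniqueness the disjointness.\<close>
  have part: "partition_on {x\<in>?X. ?\<gamma> x \<noteq> l} \<H>"
    unfolding low
  proof (rule partition_onI)
    show "\<Union>\<H> = ({..<l} \<times> {..<m}) \<times> {..<u}"
    proof (intro equalityI subsetI)
      fix x assume "x \<in> \<Union>\<H>"
      then show "x \<in> ({..<l} \<times> {..<m}) \<times> {..<u}"
        using labelled_gddD(2)[OF \<M>] by (fastforce simp: \<H>_def B\<^sub>0_def X_def)
    next
      fix x assume "x \<in> ({..<l} \<times> {..<m}) \<times> {..<u}"
      then obtain i a s where x: "x = ((i, a), s)" "i < l" "a < m" "s < u" by auto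
      have "\<exists>!B. B \<in> \<M> \<and> (i, a) \<in> B \<and> (l, t + s div \<alpha>) \<in> B"
        using x level by (intro labelled_gddD(5)[OF \<M>]) (auto simp: X_def)
      then obtain B where B: "B \<in> \<M>" "(i, a) \<in> B" "(l, t + s div \<alpha>) \<in> B"
        by (elim ex1E conjE)
      then have "B\<^sub>0 B \<times> {s} \<in> \<H>" "x \<in> B\<^sub>0 B \<times> {s}"
        using x by (auto simp: \<H>_def B\<^sub>0_def)
      then show "x \<in> \<Union>\<H>" by blast
    qed
    show "disjnt g h" if gh: "g \<in> \<H>" "h \<in> \<H>" "g \<noteq> h" for g h
    proof -
      obtain B s C r where B: "B \<in> \<M>" "(l, t + s div \<alpha>) \<in> B" "g = B\<^sub>0 B \<times> {s}"
        and C: "C \<in> \<M>" "(l, t + r div \<alpha>) \<in> C" "h = B\<^sub>0 C \<times> {r}"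
        using gh by (auto simp: \<H>_def)
      have "g = h" if "x \<in> g" "x \<in> h" for x
      proof -
        have "s = r" and "fst x \<in> B" "fst x \<in> C" "fst (fst x) \<noteq> l"
          using that B C by (auto simp: B\<^sub>0_def)
        then have "B = C"
          using labelled_gdd_block_unique[OF \<M> B(1) C(1), of "fst x"] B(2) C(2) by auto
        then show ?thesis using B C \<open>s = r\<close> by simp
      qed
      then show ?thesis using gh by (auto simp: disjnt_def)
    qed
    show "{} \<notin> \<H>"
    proof
      assume "{} \<in> \<H>"
      then obtain B where "B \<in> \<M>" "B\<^sub>0 B = {}" by (auto simp: \<H>_def)
      then show False using block(2)[of B] assms(1) by simp
    qed
  qed
  \<comment> \<open>The label \<open>Suc l\<close> is not in \<open>{..l}\<close>, so
    \<open>p\<close> is a new point.\<close>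
  define p where "p = ((Suc l, 0 :: nat), 0 :: nat)"
  have p: "p \<notin> ?X" by (simp add: p_def X_def)
  have "\<exists>\<P>. pbd (m * u + 1) K (insert p {x\<in>?X. ?\<gamma> x = i}) \<P>" if "i \<in> ?\<gamma> ` ?X - {l}" for i
  proof -
    have "i < l" using that by (auto simp: X_def)
    then have eq: "{x\<in>?X. ?\<gamma> x = i} = ({i} \<times> {..<m}) \<times> {..<u}"
      by (auto simp: X_def W_def)
    have "p \<notin> {x\<in>?X. ?\<gamma> x = i}" using p by simp
    then have "card (insert p {x\<in>?X. ?\<gamma> x = i}) = m * u + 1"
      unfolding eq by (simp add: card_cartesian_product)
    moreover have "finite (insert p {x\<in>?X. ?\<gamma> x = i})" unfolding eq by simp
    ultimately show ?thesis
      using assms(12) pbd_relabel unfolding pbd_exists_def by blast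
  qed
  then have "\<forall>i \<in> ?\<gamma> ` ?X - {l}. \<exists>\<P>. pbd (m * u + 1) K (insert p {x\<in>?X. ?\<gamma> x = i}) \<P>"
    by (rule ballI)
  from bchoice[OF this] obtain \<P> where P: "\<And>i. i \<in> ?\<gamma> ` ?X - {l} \<Longrightarrow>
      pbd (m * u + 1) K (insert p {x\<in>?X. ?\<gamma> x = i}) (\<P> i)"
    by (elim exE) (rule that, erule bspec)
  let ?Z = "insert p {x\<in>?X. ?\<gamma> x = l}"
  have "\<H> \<subseteq> (\<Union>B\<in>\<M>. \<A> B)" using horiz by (auto simp: \<H>_def)
  from labelled_gdd_blocks_to_groups[OF gdd this part p P]
  have "gdd_exists K (gdd_type (insert ?Z \<H>))"
    by (rule gdd_imp_gdd_exists)
  moreover have "gdd_type (insert ?Z \<H>) = replicate_mset (m * u) l + {#t * v + 1#}"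
  proof -
    have finH: "finite \<H>" using finite_elements[OF _ part] unfolding low by simp
    have cardh: "card h = l" if "h \<in> \<H>" for h
      using that block(2) by (auto simp: \<H>_def card_cartesian_product)
    \<comment> \<open>Counting the covered points gives \<open>l * card \<H> = l * m * u\<close>,
      and \<open>l > 0\<close> can be cancelled.\<close>
    have "l * card \<H> = card (\<Union>\<H>)"
    proof (rule card_partition)
      have "\<Union>\<H> = {x\<in>?X. ?\<gamma> x \<noteq> l}" using part by (simp add: partition_on_def)
      then show "finite (\<Union>\<H>)" unfolding low by simp
    qed (use finH cardh part in \<open>auto simp: partition_on_def disjoint_def\<close>)
    also have "\<Union>\<H> = ({..<l} \<times> {..<m}) \<times> {..<u}"
      using part unfolding low by (simp add: partition_on_def)
    finally have cH: "card \<H> = m * u" using assms(1) by (simp add: card_cartesian_product)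
    \<comment> \<open>Because \<open>t \<le> m\<close>, all \<open>t\<close> points of weight
      \<open>v\<close> exist in the last group.\<close>
    have Z: "{x\<in>?X. ?\<gamma> x = l} = ({l} \<times> {..<t}) \<times> {..<v}"
      using t_le by (auto simp: X_def W_def split: if_splits)
    have "p \<notin> {x\<in>?X. ?\<gamma> x = l}" using p by simp
    then have cZ: "card ?Z = t * v + 1" unfolding Z by (simp add: card_cartesian_product)
    \<comment> \<open>Otherwise inserting \<open>?Z\<close> would not add the group of size
      \<open>t * v + 1\<close> to the type.\<close>
    have "?Z \<notin> \<H>"
    proof
      assume "?Z \<in> \<H>"
      then have "p \<in> {x\<in>?X. ?\<gamma> x \<noteq> l}" using part unfolding partition_on_def by blast
      then show False using p by simp
    qed
    moreover have "image_mset card (mset_set \<H>) = image_mset (\<lambda>h. l) (mset_set \<H>)"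
      using finH cardh by (intro image_mset_cong) simp
    ultimately show ?thesis
      using finH cH cZ by (simp add: gdd_type_def image_mset_const_eq)
  qed
  ultimately show ?thesis by simp
qed

end
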